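(* Let $\mathbf{M}=\bigcup_{\mathcal F}M_i$ be a non-Hausdorff manifold built from an adjunction system $\mathcal F$ of Hausdorff manifolds $M_i$ glued along open subsets $A_{ij}\subseteq M_i$, in which the gluing regions have homeomorphic boundaries. If the indexing set $I$ of $\mathcal F$ is finite, then $\mathbf{M}$ is paracompact.
   Context: An adjunction system $\mathcal F$ indexed by a set $I$ consists of topological spaces $X_i$, subsets $A_{ij}\subseteq X_i$ (with the subspace topology) and continuous maps $f_{ij}:A_{ij}\to X_j$ such that for all $i,j,k\in I$: (A1) $A_{ii}=X_i$ and $f_{ii}=\mathrm{id}_{X_i}$; (A2) $A_{ji}=f_{ij}(A_{ij})$ and $f_{ij}^{-1}=f_{ji}$ (so $f_{ij}$ is a homeomorphism onto $A_{ji}$); (A3) for each $a\in A_{ij}\cap A_{ik}$ one has $f_{ij}(a)\in A_{jk}$ and $f_{ik}(a)=f_{jk}(f_{ij}(a))$. The adjunction space $\bigcup_{\mathcal F}X_i$ is the quotient (with the quotient topology) of the disjoint union $\bigsqcup_i X_i$ by the equivalence relation $(x,i)\cong(y,j)$ iff $x\in A_{ij}$ and $f_{ij}(x)=y$. All manifolds (Hausdorff or not) are locally Euclidean, second-countable and connected; a non-Hausdorff manifold is such a space that is not Hausdorff. Here $X_i=M_i$ are Hausdorff manifolds and every $A_{ij}$ is open in $M_i$. The gluing regions have homeomorphic boundaries if, for all $i\neq j$, $A_{ij}$ is a proper subset of $M_i$ and $f_{ij}$ extends to a homeomorphism $\tilde f_{ij}:\mathrm{Cl}(A_{ij})\to\mathrm{Cl}(A_{ji})$,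 with closures taken in $M_i$ and $M_j$ respectively. A space is paracompact if every open cover has a locally finite open refinement that is a cover (no Hausdorff condition is included). *)

theory Defs
  imports "HOL-Analysis.Analysis"
begin

subsection \<open>Quotient topologies\<close>

definition quotient_topology :: "'a topology \<Rightarrow> ('a \<times> 'a) set \<Rightarrow> 'a set topology" where
  "quotient_topology X r =
     topology (\<lambda>U. U \<subseteq> topspace X // r \<and> openin X {x \<in> topspace X. r `` {x} \<in> U})"

lemma openin_quotient_topology:
  "openin (quotient_topology X r) U \<longleftrightarrow>
     U \<subseteq> topspace X // r \<and> openin X {x \<in> topspace X. r `` {x} \<in> U}"
proof -
  have "{x \<in> topspace X. r `` {x} \<in> S \<inter> T} =
          {x \<in> topspace X. r `` {x} \<in> S} \<inter> {x \<in> topspace X. r `` {x} \<in> T}" for S T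
    by auto
  moreover have "{x \<in> topspace X. r `` {x} \<in> \<Union>\<K>} =
          (\<Union>K\<in>\<K>. {x \<in> topspace X. r `` {x} \<in> K})" for \<K>
    by auto
  ultimately have "istopology (\<lambda>U. U \<subseteq> topspace X // r \<and> openin X {x \<in> topspace X. r `` {x} \<in> U})"
    unfolding istopology_def by (auto intro!: openin_Union)
  then show ?thesis
    by (simp add: quotient_topology_def)
qed

lemma topspace_quotient_topology [simp]:
  "topspace (quotient_topology X r) = topspace X // r"
proof -
  have "{x \<in> topspace X. r `` {x} \<in> topspace X // r} = topspace X"
    by (auto intro: quotientI)
  then have "openin (quotient_topology X r) (topspace X // r)"
    by (simp add: openin_quotient_topology)
  then show ?thesis
    by (metis openin_quotient_topology openin_subset openin_topspace subset_antisym)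
qed

lemma quotient_map_quotient_topology:
  "quotient_map X (quotient_topology X r) (\<lambda>x. r `` {x})"
  by (auto simp: quotient_map_def openin_quotient_topology quotient_def)


subsection \<open>Adjunction systems and adjunction spaces\<close>

text \<open>
  The space with index \<open>i \<in> I\<close> is \<open>X i\<close>, and \<open>f i j\<close> matters only on \<open>A i j\<close>.
  Assumption \<open>inverse\<close>, used for \<open>(i, j)\<close> and \<open>(j, i)\<close> and together with \<open>image\<close>, says
  that \<open>f i j : A i j \<rightarrow> A j i\<close> and \<open>f j i : A j i \<rightarrow> A i j\<close> are mutually inverse.
\<close>

locale adjunction_system =
  fixes I :: "'i set"
    and X :: "'i \<Rightarrow> 'a topology"
    and A :: "'i \<Rightarrow> 'i \<Rightarrow> 'a set"
    and f :: "'i \<Rightarrow> 'i \<Rightarrow> 'a \<Rightarrow> 'a"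
  assumes subset: "\<lbrakk>i \<in> I; j \<in> I\<rbrakk> \<Longrightarrow> A i j \<subseteq> topspace (X i)"
    and continuous: "\<lbrakk>i \<in> I; j \<in> I\<rbrakk> \<Longrightarrow> continuous_map (subtopology (X i) (A i j)) (X j) (f i j)"
    and diag: "i \<in> I \<Longrightarrow> A i i = topspace (X i)"
    and diag_id: "\<lbrakk>i \<in> I; x \<in> topspace (X i)\<rbrakk> \<Longrightarrow> f i i x = x"
    and image: "\<lbrakk>i \<in> I; j \<in> I\<rbrakk> \<Longrightarrow> A j i = f i j ` A i j"
    and inverse: "\<lbrakk>i \<in> I; j \<in> I; a \<in> A i j\<rbrakk> \<Longrightarrow> f j i (f i j a) = a"
    and cocycle_mem: "\<lbrakk>i \<in> I; j \<in> I; k \<in> I; a \<in> A i j \<inter> A i k\<rbrakk> \<Longrightarrow> f i j a \<in> A j k"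
    and cocycle: "\<lbrakk>i \<in> I; j \<in> I; k \<in> I; a \<in> A i j \<inter> A i k\<rbrakk> \<Longrightarrow> f i k a = f j k (f i j a)"

text \<open>Points of the disjoint union are written \<open>(i, x)\<close>, as in \<^const>\<open>sum_topology\<close>.\<close>

definition adjunction_rel ::
  "'i set \<Rightarrow> ('i \<Rightarrow> 'i \<Rightarrow> 'a set) \<Rightarrow> ('i \<Rightarrow> 'i \<Rightarrow> 'a \<Rightarrow> 'a) \<Rightarrow> (('i \<times> 'a) \<times> ('i \<times> 'a)) set" where
  "adjunction_rel I A f =
     {((i, x), (j, y)). i \<in> I \<and> j \<in> I \<and> x \<in> A i j \<and> f i j x = y}"

definition adjunction_space ::
  "'i set \<Rightarrow> ('i \<Rightarrow> 'a topology) \<Rightarrow> ('i \<Rightarrow> 'i \<Rightarrow> 'a set) \<Rightarrow> ('i \<Rightarrow> 'i \<Rightarrow> 'a \<Rightarrow> 'a)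
     \<Rightarrow> ('i \<times> 'a) set topology" where
  "adjunction_space I X A f = quotient_topology (sum_topology X I) (adjunction_rel I A f)"

lemma (in adjunction_system) equiv_adjunction_rel:
  "equiv (topspace (sum_topology X I)) (adjunction_rel I A f)"
proof (rule equivI)
  show "adjunction_rel I A f \<subseteq> topspace (sum_topology X I) \<times> topspace (sum_topology X I)"
  proof
    fix p
    assume "p \<in> adjunction_rel I A f"
    then obtain i x j where p: "p = ((i, x), (j, f i j x))" and ij: "i \<in> I" "j \<in> I" and x: "x \<in> A i j"
      by (auto simp: adjunction_rel_def)
    have "f i j x \<in> A j i"
      using image[OF ij] x by blast
    then show "p \<in> topspace (sum_topology X I) \<times> topspace (sum_topology X I)"
      using subset[OF ij] subset[OF ij(2,1)] ij x by (auto simp: p)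
  qed
  show "refl_on (topspace (sum_topology X I)) (adjunction_rel I A f)"
    by (auto simp: refl_on_def adjunction_rel_def diag diag_id)
  show "sym (adjunction_rel I A f)"
  proof (rule symI)
    fix p q
    assume "(p, q) \<in> adjunction_rel I A f"
    then obtain i x j where pq: "p = (i, x)" "q = (j, f i j x)" and ij: "i \<in> I" "j \<in> I" and x: "x \<in> A i j"
      by (auto simp: adjunction_rel_def)
    have "f i j x \<in> A j i"
      using image[OF ij] x by blast
    then show "(q, p) \<in> adjunction_rel I A f"
      using inverse[OF ij x] ij by (simp add: pq adjunction_rel_def)
  qed
  show "trans (adjunction_rel I A f)"
  proof (rule transI)
    fix p q r
    assume pq: "(p, q) \<in> adjunction_rel I A f" and qr: "(q, r) \<in> adjunction_rel I A f"
    obtain i x j y k z where [simp]: "p = (i, x)" "q = (j, y)" "r = (k, z)"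
      by (metis surj_pair)
    have ijk: "i \<in> I" "j \<in> I" "k \<in> I" and x: "x \<in> A i j" "f i j x = y"
      and y: "y \<in> A j k" "f j k y = z"
      using pq qr by (auto simp: adjunction_rel_def)
    have yx: "f j i y = x" "y \<in> A j i"
      using image[OF ijk(1,2)] inverse[OF ijk(1,2) x(1)] x by blast+
    then have "x \<in> A i k"
      using cocycle_mem[OF ijk(2,1,3), of y] y by simp
    then show "(p, r) \<in> adjunction_rel I A f"
      using cocycle[OF ijk, of x] ijk x y by (simp add: adjunction_rel_def)
  qed
qed

definition homeomorphic_boundaries ::
  "'i set \<Rightarrow> ('i \<Rightarrow> 'a topology) \<Rightarrow> ('i \<Rightarrow> 'i \<Rightarrow> 'a set) \<Rightarrow> ('i \<Rightarrow> 'i \<Rightarrow> 'a \<Rightarrow> 'a) \<Rightarrow> bool" where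
  "homeomorphic_boundaries I M A f \<longleftrightarrow>
     (\<forall>i\<in>I. \<forall>j\<in>I. i \<noteq> j \<longrightarrow>
        A i j \<subset> topspace (M i) \<and>
        (\<exists>g. homeomorphic_map (subtopology (M i) (M i closure_of A i j))
                               (subtopology (M j) (M j closure_of A j i)) g \<and>
             (\<forall>x\<in>A i j. g x = f i j x)))"


subsection \<open>Manifolds and paracompactness, without a Hausdorff condition\<close>

definition locally_euclidean :: "'a topology \<Rightarrow> bool" where
  "locally_euclidean X \<longleftrightarrow>
     (\<exists>n. \<forall>x\<in>topspace X. \<exists>U V. openin X U \<and> x \<in> U \<and> openin (Euclidean_space n) V \<and>
        subtopology X U homeomorphic_space subtopology (Euclidean_space n) V)"

definition manifold :: "'a topology \<Rightarrow> bool" where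
  "manifold X \<longleftrightarrow> locally_euclidean X \<and> second_countable X \<and> connected_space X"

definition non_Hausdorff_manifold :: "'a topology \<Rightarrow> bool" where
  "non_Hausdorff_manifold X \<longleftrightarrow> manifold X \<and> \<not> Hausdorff_space X"

definition paracompact_space :: "'a topology \<Rightarrow> bool" where
  "paracompact_space X \<longleftrightarrow>
     (\<forall>\<U>. (\<forall>U\<in>\<U>. openin X U) \<and> \<Union>\<U> = topspace X \<longrightarrow>
        (\<exists>\<V>. (\<forall>V\<in>\<V>. openin X V) \<and> \<Union>\<V> = topspace X \<and>
             (\<forall>V\<in>\<V>. \<exists>U\<in>\<U>. V \<subseteq> U) \<and> locally_finite_in X \<V>))"

end

theory Submission
  imports Defs
begin

text \<open>
  Each \<open>M i\<close> is regular and Lindelof, hence paracompact. An open refinement that is locally finite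
  in \<open>M i\<close> stays locally finite in the adjunction space: a point \<open>x\<close> of \<open>M j\<close> either has a
  neighbourhood missing \<open>M i\<close>, or lies in the closure of \<open>A j i\<close>, and then the neighbourhood of the
  point of \<open>M i\<close> that corresponds to \<open>x\<close> under the extended gluing map can be pulled back to one
  of \<open>x\<close>. Finitely many such refinements together form a locally finite refinement.
\<close>

section \<open>Paracompactness of Hausdorff manifolds\<close>

text \<open>Compact neighbourhoods are carried over from an open part of Euclidean space through a
  chart; one inside the chart domain \<open>U\<close> still serves in \<open>X\<close> because
  \<open>U\<close> is open. Together with the Hausdorff property this yields regularity
  later.\<close>

lemma locally_euclidean_imp_locally_compact_space:
  assumes "locally_euclidean X"
  shows "locally_compact_space X"
  unfolding locally_compact_space_def
proof
  fix x
  assume "x \<in> topspace X"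
  then obtain n U V where U: "openin X U" "x \<in> U" and V: "openin (Euclidean_space n) V"
    and hom: "subtopology X U homeomorphic_space subtopology (Euclidean_space n) V"
    using assms unfolding locally_euclidean_def by blast
  have "locally_compact_space (subtopology (Euclidean_space n) V)"
    using V by (simp add: locally_compact_space_open_subset Hausdorff_Euclidean_space
        locally_compact_Euclidean_space)
  then have "locally_compact_space (subtopology X U)"
    using hom homeomorphic_locally_compact_space by blast
  moreover have "x \<in> topspace (subtopology X U)"
    using U openin_subset by fastforce
  ultimately obtain W K where "openin (subtopology X U) W" "compactin (subtopology X U) K"
    "x \<in> W" "W \<subseteq> K"
    unfolding locally_compact_space_def by blast
  with U show "\<exists>W K. openin X W \<and> compactin X K \<and> x \<in> W \<and> W \<subseteq> K"
    by (meson compactin_subtopology openin_trans_full)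
qed

text \<open>
  Regularity and the Lindelof property give countable open covers \<open>N n\<close> and \<open>W n\<close>, with the closure
  of \<open>N n\<close> inside \<open>W n\<close>. Removing from \<open>W n\<close> the closures of all earlier \<open>N k\<close> keeps a cover and
  makes \<open>N m\<close> disjoint from every later member.
\<close>

lemma regular_Lindelof_imp_paracompact_space:
  assumes reg: "regular_space X" and Lin: "Lindelof_space X"
  shows "paracompact_space X"
  unfolding paracompact_space_def
proof (intro allI impI)
  fix \<U>
  assume \<U>: "(\<forall>U\<in>\<U>. openin X U) \<and> \<Union>\<U> = topspace X"
  define \<N> where "\<N> = {N. openin X N \<and> (\<exists>U\<in>\<U>. X closure_of N \<subseteq> U)}"
  have "\<exists>N\<in>\<N>. x \<in> N" if x: "x \<in> topspace X" for x
  proof -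
    obtain U where U: "U \<in> \<U>" "x \<in> U"
      using \<U> x by blast
    then have "closedin X (topspace X - U)"
      using \<U> by blast
    then obtain N where N: "openin X N" "x \<in> N" "disjnt (topspace X - U) (X closure_of N)"
      using reg U x unfolding regular_space by blast
    then have "X closure_of N \<subseteq> U"
      using closure_of_subset_topspace[of X N] by (auto simp: disjnt_iff)
    then show ?thesis
      using N U by (auto simp: \<N>_def)
  qed
  moreover have "\<Union>\<N> \<subseteq> topspace X"
    using openin_subset by (fastforce simp: \<N>_def)
  ultimately have "\<Union>\<N> = topspace X"
    by blast
  then obtain \<C> where \<C>: "countable \<C>" "\<C> \<subseteq> \<N>" "\<Union>\<C> = topspace X"
    using Lindelof_spaceD[OF Lin, of \<N>] by (auto simp: \<N>_def)
  show "\<exists>\<V>. (\<forall>V\<in>\<V>. openin X V) \<and> \<Union>\<V> = topspace X \<and>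
             (\<forall>V\<in>\<V>. \<exists>U\<in>\<U>. V \<subseteq> U) \<and> locally_finite_in X \<V>"
  proof (cases "\<C> = {}")
    case True
    then show ?thesis
      using \<C> by (intro exI[of _ "{}"]) (auto simp: locally_finite_in_def)
  next
    case False
    \<comment> \<open>The enumeration runs over all naturals, possibly with repetitions, which
      requires \<open>\<C>\<close> to be nonempty.\<close>
    define N where "N = from_nat_into \<C>"
    have range_N: "range N = \<C>"
      using False \<C> by (simp add: N_def range_from_nat_into)
    have "N n \<in> \<N>" for n
      using range_N \<C>(2) by blast
    then have N: "openin X (N n)" "\<exists>U\<in>\<U>. X closure_of (N n) \<subseteq> U" for n
      by (auto simp: \<N>_def)
    have N_cover: "\<exists>m. x \<in> N m" if "x \<in> topspace X" for x
      using that \<C>(3) range_N by (metis UN_E)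
    from N obtain W where W: "\<And>n. W n \<in> \<U>" "\<And>n. X closure_of (N n) \<subseteq> W n"
      by metis
    define V where "V n = W n - (\<Union>k<n. X closure_of (N k))" for n
    have sub: "N n \<subseteq> X closure_of (N n)" for n
      using N by (simp add: closure_of_subset openin_subset)
    have open_V: "openin X (V n)" for n
      unfolding V_def using \<U> W by (intro openin_diff closedin_Union) auto
    have "topspace X \<subseteq> \<Union>(range V)"
    proof
      fix x
      assume "x \<in> topspace X"
      then obtain m where "x \<in> N m"
        using N_cover by blast
      then have m: "x \<in> W m"
        using sub W by blast
      \<comment> \<open>With the least index, \<open>x\<close> lies in no earlier
        \<open>W k\<close>, hence in no earlier closure of \<open>N k\<close>, and is not removed
        from \<open>W n\<close>.\<close>
      define n where "n = (LEAST n. x \<in> W n)"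
      have "x \<in> W n"
        unfolding n_def by (rule LeastI[of "\<lambda>n. x \<in> W n", OF m])
      moreover have "x \<notin> W k" if "k < n" for k
        using that not_less_Least unfolding n_def by blast
      ultimately have "x \<in> V n"
        using W by (auto simp: V_def)
      then show "x \<in> \<Union>(range V)"
        by blast
    qed
    then have cover: "\<Union>(range V) = topspace X"
      using open_V openin_subset by blast
    have "\<exists>T. openin X T \<and> x \<in> T \<and> finite {U \<in> range V. U \<inter> T \<noteq> {}}"
      if x: "x \<in> topspace X" for x
    proof -
      obtain m where m: "x \<in> N m"
        using N_cover x by blast
      have "V n \<inter> N m = {}" if "m < n" for n
        using that sub by (auto simp: V_def)
      then have "{U \<in> range V. U \<inter> N m \<noteq> {}} \<subseteq> V ` {..m}"
        by (auto simp: image_iff) (metis atMost_iff disjoint_iff not_le)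
      then have "finite {U \<in> range V. U \<inter> N m \<noteq> {}}"
        by (rule finite_subset) simp
      then show ?thesis
        using m N by blast
    qed
    then have "locally_finite_in X (range V)"
      using cover by (simp add: locally_finite_in_def)
    moreover have "\<exists>U\<in>\<U>. V n \<subseteq> U" for n
      using W(1)[of n] by (auto simp: V_def)
    ultimately show ?thesis
      using cover open_V by (intro exI[of _ "range V"]) simp
  qed
qed

lemma Hausdorff_manifold_imp_paracompact_space:
  assumes "manifold X" "Hausdorff_space X"
  shows "paracompact_space X"
  using assms unfolding manifold_def
  by (meson regular_Lindelof_imp_paracompact_space locally_compact_Hausdorff_imp_regular_space
      locally_euclidean_imp_locally_compact_space second_countable_imp_Lindelof_space)

section \<open>Finite unions of locally finite families\<close>

lemma locally_finite_in_Un: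
  assumes "locally_finite_in X \<A>" "locally_finite_in X \<B>"
  shows "locally_finite_in X (\<A> \<union> \<B>)"
  unfolding locally_finite_in_def
proof (intro conjI ballI)
  show "\<Union>(\<A> \<union> \<B>) \<subseteq> topspace X"
    using assms by (auto simp: locally_finite_in_def)
next
  fix x
  assume "x \<in> topspace X"
  then obtain V W where V: "openin X V" "x \<in> V" "finite {U \<in> \<A>. U \<inter> V \<noteq> {}}"
    and W: "openin X W" "x \<in> W" "finite {U \<in> \<B>. U \<inter> W \<noteq> {}}"
    using assms unfolding locally_finite_in_def by meson
  have "{U \<in> \<A> \<union> \<B>. U \<inter> (V \<inter> W) \<noteq> {}} \<subseteq> {U \<in> \<A>. U \<inter> V \<noteq> {}} \<union> {U \<in> \<B>. U \<inter> W \<noteq> {}}"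
    by blast
  then have "finite {U \<in> \<A> \<union> \<B>. U \<inter> (V \<inter> W) \<noteq> {}}"
    using V W by (meson finite_UnI finite_subset)
  then show "\<exists>V. openin X V \<and> x \<in> V \<and> finite {U \<in> \<A> \<union> \<B>. U \<inter> V \<noteq> {}}"
    using V W by blast
qed

text \<open>This is where finiteness of the index set enters the argument.\<close>

lemma locally_finite_in_UN:
  assumes "finite I" "\<And>i. i \<in> I \<Longrightarrow> locally_finite_in X (\<A> i)"
  shows "locally_finite_in X (\<Union>i\<in>I. \<A> i)"
  using assms
proof (induction I)
  case empty
  show ?case
    by (simp add: finite_imp_locally_finite_in)
next
  case (insert i I)
  then show ?case
    by (simp add: locally_finite_in_Un)
qed

section \<open>The canonical maps into the adjunction space\<close>

text \<open>The canonical map from \<open>X i\<close> into the adjunction space, sending a point to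
  its class.\<close>

definition glue ::
  "'i set \<Rightarrow> ('i \<Rightarrow> 'i \<Rightarrow> 'a set) \<Rightarrow> ('i \<Rightarrow> 'i \<Rightarrow> 'a \<Rightarrow> 'a) \<Rightarrow> 'i \<Rightarrow> 'a \<Rightarrow> ('i \<times> 'a) set" where
  "glue I A f i x = adjunction_rel I A f `` {(i, x)}"

context adjunction_system
begin

lemma topspace_adjunction_space:
  "topspace (adjunction_space I X A f) = (\<Union>i\<in>I. glue I A f i ` topspace (X i))"
  by (fastforce simp: adjunction_space_def quotient_def glue_def)

lemma glue_eq_iff:
  assumes "i \<in> I" "j \<in> I" "x \<in> topspace (X i)" "y \<in> topspace (X j)"
  shows "glue I A f i x = glue I A f j y \<longleftrightarrow> x \<in> A i j \<and> f i j x = y"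
proof -
  have "glue I A f i x = glue I A f j y \<longleftrightarrow> ((i, x), (j, y)) \<in> adjunction_rel I A f"
    unfolding glue_def using assms by (intro eq_equiv_class_iff[OF equiv_adjunction_rel]) auto
  then show ?thesis
    using assms by (simp add: adjunction_rel_def)
qed

text \<open>The quotient topology is the final topology for the canonical maps, because openness in
  a disjoint union is tested on each summand.\<close>

lemma openin_adjunction_space:
  "openin (adjunction_space I X A f) U \<longleftrightarrow>
     U \<subseteq> topspace (adjunction_space I X A f) \<and>
     (\<forall>i\<in>I. openin (X i) {x \<in> topspace (X i). glue I A f i x \<in> U})"
proof -
  have "{x. (i, x) \<in> {p \<in> topspace (sum_topology X I). adjunction_rel I A f `` {p} \<in> U}} =
      {x \<in> topspace (X i). glue I A f i x \<in> U}" if "i \<in> I" for i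
    using that by (auto simp: glue_def)
  then show ?thesis
    unfolding adjunction_space_def openin_quotient_topology openin_sum_topology
      topspace_quotient_topology by (auto simp del: mem_Collect_eq)
qed

text \<open>Seen from \<open>X j\<close>, the image of \<open>U\<close> is the preimage of
  \<open>U\<close> under \<open>f j i\<close>. It is open in \<open>A j i\<close> by continuity,
  hence in \<open>X j\<close> because \<open>A j i\<close> is open.\<close>

lemma open_map_glue:
  assumes i: "i \<in> I" and A: "\<And>j. j \<in> I \<Longrightarrow> openin (X j) (A j i)"
  shows "open_map (X i) (adjunction_space I X A f) (glue I A f i)"
  unfolding open_map_def
proof (intro allI impI)
  fix U
  assume U: "openin (X i) U"
  have "openin (X j) {y \<in> topspace (X j). glue I A f j y \<in> glue I A f i ` U}" if j: "j \<in> I" for j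
  proof -
    have "{y \<in> topspace (X j). glue I A f j y \<in> glue I A f i ` U} =
        {y \<in> topspace (subtopology (X j) (A j i)). f j i y \<in> U}"
      using glue_eq_iff[OF j i] openin_subset[OF U] by (auto simp: image_iff)
    moreover have "openin (subtopology (X j) (A j i))
        {y \<in> topspace (subtopology (X j) (A j i)). f j i y \<in> U}"
      using continuous[OF j i] U by (simp only: openin_continuous_map_preimage)
    ultimately show ?thesis
      using A[OF j] openin_trans_full by metis
  qed
  then show "openin (adjunction_space I X A f) (glue I A f i ` U)"
    using i openin_subset[OF U] unfolding openin_adjunction_space topspace_adjunction_space by blast
qed

section \<open>Local finiteness and paracompactness in the adjunction space\<close>

text \<open>The extensions in \<open>ext\<close> run from \<open>X j\<close> to the fixed
  \<open>X i\<close>, since neighbourhoods in \<open>X i\<close> are pulled back to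
  \<open>X j\<close>.\<close>

lemma locally_finite_in_glue:
  assumes i: "i \<in> I" and A: "\<And>j k. \<lbrakk>j \<in> I; k \<in> I\<rbrakk> \<Longrightarrow> openin (X j) (A j k)"
    and ext: "\<And>j. j \<in> I \<Longrightarrow> \<exists>g. continuous_map (subtopology (X j) (X j closure_of A j i)) (X i) g \<and>
      (\<forall>x\<in>A j i. g x = f j i x)"
    and \<V>: "locally_finite_in (X i) \<V>"
  shows "locally_finite_in (adjunction_space I X A f) ((`) (glue I A f i) ` \<V>)"
  unfolding locally_finite_in_def
proof (intro conjI ballI)
  have sub_\<V>: "\<Union>\<V> \<subseteq> topspace (X i)"
    using \<V> by (simp add: locally_finite_in_def)
  then show "\<Union>((`) (glue I A f i) ` \<V>) \<subseteq> topspace (adjunction_space I X A f)"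
    using i unfolding topspace_adjunction_space by blast
  fix p
  assume "p \<in> topspace (adjunction_space I X A f)"
  then obtain j x where j: "j \<in> I" and x: "x \<in> topspace (X j)" and p: "p = glue I A f j x"
    unfolding topspace_adjunction_space by blast
  \<comment> \<open>\<open>W\<close> bounds the part of \<open>X i\<close> that \<open>N\<close>
    reaches through the gluing, so that finiteness for \<open>W\<close> transfers to the image of
    \<open>N\<close>.\<close>
  have "\<exists>N W. openin (X j) N \<and> x \<in> N \<and> (\<forall>z\<in>N \<inter> A j i. f j i z \<in> W) \<and>
      finite {V \<in> \<V>. V \<inter> W \<noteq> {}}"
  proof (cases "x \<in> X j closure_of A j i")
    case False
    have "openin (X j) (topspace (X j) - X j closure_of A j i)"
      by (simp add: openin_diff)
    moreover have "(topspace (X j) - X j closure_of A j i) \<inter> A j i = {}"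
      using closure_of_subset[OF subset[OF j i]] by blast
    ultimately show ?thesis
      \<comment> \<open>Here \<open>N\<close> misses \<open>A j i\<close> and reaches nothing in
        \<open>X i\<close>, so \<open>W\<close> is empty.\<close>
      using False x
      by (intro exI[of _ "topspace (X j) - X j closure_of A j i"] exI[of _ "{}"]) auto
  next
    case True
    obtain g where g: "continuous_map (subtopology (X j) (X j closure_of A j i)) (X i) g"
      and gf: "\<forall>x\<in>A j i. g x = f j i x"
      using ext[OF j] by blast
    have "g x \<in> topspace (X i)"
      using g True x by (auto simp: continuous_map_def)
    then obtain W where W: "openin (X i) W" "g x \<in> W" "finite {V \<in> \<V>. V \<inter> W \<noteq> {}}"
      using \<V> unfolding locally_finite_in_def by meson
    \<comment> \<open>The preimage of \<open>W\<close> under \<open>g\<close> is open only relative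
      to the closure of \<open>A j i\<close>; \<open>N\<close> is an open set of \<open>X j\<close>
      with that trace. It may extend beyond the closure, but only its points in \<open>A j i\<close>
      are glued to \<open>X i\<close>.\<close>
    obtain N where N: "openin (X j) N"
      "{z \<in> topspace (subtopology (X j) (X j closure_of A j i)). g z \<in> W} =
        N \<inter> X j closure_of A j i"
      using openin_continuous_map_preimage[OF g W(1)] unfolding openin_subtopology by blast
    have "x \<in> N"
      using N(2) True W(2) x by auto
    moreover have "f j i z \<in> W" if "z \<in> N \<inter> A j i" for z
      proof -
      have "z \<in> {z \<in> topspace (subtopology (X j) (X j closure_of A j i)). g z \<in> W}"
        unfolding N(2) using that closure_of_subset[OF subset[OF j i]] by blast
      then show ?thesis
        using that gf by simp
    qed
    ultimately show ?thesis
      using N(1) W(3) by blast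
  qed
  then obtain N W where N: "openin (X j) N" "x \<in> N" "\<And>z. z \<in> N \<inter> A j i \<Longrightarrow> f j i z \<in> W"
    and W: "finite {V \<in> \<V>. V \<inter> W \<noteq> {}}"
    by blast
  \<comment> \<open>A common class has representatives \<open>z\<close> in \<open>N\<close> and
    \<open>v\<close> in \<open>V\<close>; being identified, they satisfy \<open>f j i z = v\<close>,
    which puts \<open>v\<close> in \<open>W\<close>.\<close>
  have "V \<inter> W \<noteq> {}" if V: "V \<in> \<V>" and ne: "glue I A f i ` V \<inter> glue I A f j ` N \<noteq> {}" for V
  proof -
    obtain v z where vz: "v \<in> V" "z \<in> N" "glue I A f j z = glue I A f i v"
      using ne by force
    have "z \<in> topspace (X j)" "v \<in> topspace (X i)"
      using vz V sub_\<V> openin_subset[OF N(1)] by blast+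
    then have "z \<in> A j i" "f j i z = v"
      using glue_eq_iff[OF j i] vz(3) by simp_all
    then show ?thesis
      using N(3) vz by blast
  qed
  then have "{U \<in> (`) (glue I A f i) ` \<V>. U \<inter> glue I A f j ` N \<noteq> {}} \<subseteq>
      (`) (glue I A f i) ` {V \<in> \<V>. V \<inter> W \<noteq> {}}"
    by auto
  then have "finite {U \<in> (`) (glue I A f i) ` \<V>. U \<inter> glue I A f j ` N \<noteq> {}}"
    using W by (meson finite_imageI finite_subset)
  moreover have "openin (adjunction_space I X A f) (glue I A f j ` N)"
    using open_map_glue[OF j A[OF _ j]] N(1) by (simp add: open_map_def)
  ultimately show "\<exists>T. openin (adjunction_space I X A f) T \<and> p \<in> T \<and>
      finite {U \<in> (`) (glue I A f i) ` \<V>. U \<inter> T \<noteq> {}}"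
    using N(2) p by blast
qed

text \<open>A cover is pulled back along each canonical map, refined in each \<open>X i\<close>, and
  the refinements are pushed forward by the open canonical maps.\<close>

lemma paracompact_adjunction_space:
  assumes fin: "finite I" and para: "\<And>i. i \<in> I \<Longrightarrow> paracompact_space (X i)"
    and A: "\<And>i j. \<lbrakk>i \<in> I; j \<in> I\<rbrakk> \<Longrightarrow> openin (X i) (A i j)"
    and ext: "\<And>i j. \<lbrakk>i \<in> I; j \<in> I\<rbrakk> \<Longrightarrow>
      \<exists>g. continuous_map (subtopology (X i) (X i closure_of A i j)) (X j) g \<and>
        (\<forall>x\<in>A i j. g x = f i j x)"
  shows "paracompact_space (adjunction_space I X A f)"
  unfolding paracompact_space_def
proof (intro allI impI)
  let ?Y = "adjunction_space I X A f"
  fix \<U>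
  assume \<U>: "(\<forall>U\<in>\<U>. openin ?Y U) \<and> \<Union>\<U> = topspace ?Y"
  have "\<exists>\<V>. (\<forall>V\<in>\<V>. openin (X i) V) \<and> \<Union>\<V> = topspace (X i) \<and>
      (\<forall>V\<in>\<V>. \<exists>U\<in>\<U>. glue I A f i ` V \<subseteq> U) \<and> locally_finite_in (X i) \<V>" if i: "i \<in> I" for i
  proof -
    let ?P = "\<lambda>U. {x \<in> topspace (X i). glue I A f i x \<in> U}"
    have "glue I A f i x \<in> \<Union>\<U>" if "x \<in> topspace (X i)" for x
    proof -
      have "glue I A f i x \<in> topspace ?Y"
        using i that unfolding topspace_adjunction_space by blast
      then show ?thesis
        using \<U> by simp
    qed
    then have "\<Union>(?P ` \<U>) = topspace (X i)"
      by auto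
    moreover have "\<forall>U\<in>?P ` \<U>. openin (X i) U"
      using \<U> i unfolding openin_adjunction_space by blast
    ultimately have "\<exists>\<V>. (\<forall>V\<in>\<V>. openin (X i) V) \<and> \<Union>\<V> = topspace (X i) \<and>
        (\<forall>V\<in>\<V>. \<exists>U\<in>?P ` \<U>. V \<subseteq> U) \<and> locally_finite_in (X i) \<V>"
      by (intro para[OF i, unfolded paracompact_space_def, rule_format] conjI)
    then obtain \<V> where "\<forall>V\<in>\<V>. openin (X i) V" "\<Union>\<V> = topspace (X i)"
      "\<forall>V\<in>\<V>. \<exists>U\<in>?P ` \<U>. V \<subseteq> U" "locally_finite_in (X i) \<V>"
      by (elim exE conjE)
    moreover have "\<exists>U\<in>\<U>. glue I A f i ` V \<subseteq> U" if "\<exists>U\<in>?P ` \<U>. V \<subseteq> U" for V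
      using that by blast
    ultimately show ?thesis
      by (intro exI[of _ \<V>] conjI) simp_all
  qed
  then obtain \<V> where \<V>: "\<And>i V. \<lbrakk>i \<in> I; V \<in> \<V> i\<rbrakk> \<Longrightarrow> openin (X i) V"
    "\<And>i. i \<in> I \<Longrightarrow> \<Union>(\<V> i) = topspace (X i)"
    "\<And>i V. \<lbrakk>i \<in> I; V \<in> \<V> i\<rbrakk> \<Longrightarrow> \<exists>U\<in>\<U>. glue I A f i ` V \<subseteq> U"
    "\<And>i. i \<in> I \<Longrightarrow> locally_finite_in (X i) (\<V> i)"
    by metis
  let ?\<W> = "\<Union>i\<in>I. (`) (glue I A f i) ` \<V> i"
  have "locally_finite_in ?Y ?\<W>"
    using fin locally_finite_in_glue A ext \<V>(4) by (intro locally_finite_in_UN) auto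
  moreover have "\<Union>?\<W> = (\<Union>i\<in>I. glue I A f i ` \<Union>(\<V> i))"
    by blast
  then have "\<Union>?\<W> = topspace ?Y"
    using \<V>(2) unfolding topspace_adjunction_space by simp
  moreover have "\<forall>W\<in>?\<W>. openin ?Y W"
    using open_map_glue A \<V>(1) by (fastforce simp: open_map_def)
  moreover have "\<forall>W\<in>?\<W>. \<exists>U\<in>\<U>. W \<subseteq> U"
    using \<V>(3) by blast
  ultimately show "\<exists>\<V>. (\<forall>V\<in>\<V>. openin ?Y V) \<and> \<Union>\<V> = topspace ?Y \<and>
      (\<forall>V\<in>\<V>. \<exists>U\<in>\<U>. V \<subseteq> U) \<and> locally_finite_in ?Y \<V>"
    by blast
qed

end

theorem theorem2p5:
  fixes I :: "'i set"
    and M :: "'i \<Rightarrow> 'a topology"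
    and A :: "'i \<Rightarrow> 'i \<Rightarrow> 'a set"
    and f :: "'i \<Rightarrow> 'i \<Rightarrow> 'a \<Rightarrow> 'a"
  assumes "adjunction_system I M A f"
    and "\<And>i. i \<in> I \<Longrightarrow> manifold (M i)"
    and "\<And>i. i \<in> I \<Longrightarrow> Hausdorff_space (M i)"
    and "\<And>i j. \<lbrakk>i \<in> I; j \<in> I\<rbrakk> \<Longrightarrow> openin (M i) (A i j)"
    and "non_Hausdorff_manifold (adjunction_space I M A f)"
    and "homeomorphic_boundaries I M A f"
    and "finite I"
  shows "paracompact_space (adjunction_space I M A f)"
proof -
  interpret adjunction_system I M A f
    by fact
  have "\<exists>g. continuous_map (subtopology (M i) (M i closure_of A i j)) (M j) g \<and>
      (\<forall>x\<in>A i j. g x = f i j x)" if ij: "i \<in> I" "j \<in> I" for i j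
  \<comment> \<open>The boundary hypothesis covers distinct indices only. For \<open>i = j\<close>
    the gluing region is the whole space and the identity extends the gluing map.\<close>
  proof (cases "i = j")
    case True
    then show ?thesis
      using ij diag diag_id by (intro exI[of _ id]) (auto intro: continuous_map_from_subtopology)
  next
    case False
    then obtain g where g: "homeomorphic_map (subtopology (M i) (M i closure_of A i j))
        (subtopology (M j) (M j closure_of A j i)) g" "\<forall>x\<in>A i j. g x = f i j x"
      using assms(6) ij unfolding homeomorphic_boundaries_def by blast
    \<comment> \<open>A homeomorphism onto the closure of \<open>A j i\<close> is continuous as a
      map into \<open>M j\<close>.\<close>
    then show ?thesis
      by (metis homeomorphic_imp_continuous_map continuous_map_in_subtopology)
  qed
  then show ?thesis
    using assms(2-4,7) Hausdorff_manifold_imp_paracompact_space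
    by (intro paracompact_adjunction_space) blast+
qed

end
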